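(* Let $(N_n)_{n\in\mathbb Z_-}$ be a sequence of positive integers and let $(P_n)_{n\in\mathbb N_-}$ be a sequence of stochastic matrices, where $P_n$ has dimension $N_n\times N_{n+1}$. For $n\le 0$ let $$D(n)=\Big\{x\in\mathbb R^{N_n}:\ \sum_{i=1}^{N_n}x(i)=1,\ x(1),\dots,x(N_n)\ge 0\Big\}.$$ Then there exists at least one sequence of (row) vectors $(m_n)_{n\in\mathbb Z_-}$ such that $m_n\in D(n)$ for every $n\in\mathbb Z_-$ and $m_{n+1}=m_nP_n$ for every $n\in\mathbb N_-$.
   Context: $\mathbb Z_-=\{\dots,-2,-1,0\}$ and $\mathbb N_-=\{\dots,-2,-1\}$. Elements of $\mathbb R^d$ are row vectors and $x(i)$ is the $i$th coordinate of $x$. A matrix is stochastic if its entries are nonnegative and each row sums to $1$. The sequence $(N_n)$ may be unbounded as $n\to-\infty$. *)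

theory Defs
  imports Complex_Main "Jordan_Normal_Form.Matrix"
begin

text \<open>
  Vectors and matrices are indexed from \<open>0\<close>, so the coordinate \<open>x(i)\<close> is \<open>x $ (i - 1)\<close>.
\<close>

definition stochastic_mat :: "real mat \<Rightarrow> bool" where
  "stochastic_mat A \<longleftrightarrow>
     (\<forall>i<dim_row A. \<forall>j<dim_col A. 0 \<le> A $$ (i, j)) \<and>
     (\<forall>i<dim_row A. (\<Sum>j<dim_col A. A $$ (i, j)) = 1)"

text \<open>The set \<open>D(n)\<close> is \<open>prob_vecs (N n)\<close>.\<close>

definition prob_vecs :: "nat \<Rightarrow> real vec set" where
  "prob_vecs k = {x \<in> carrier_vec k. (\<Sum>i<k. x $ i) = 1 \<and> (\<forall>i<k. 0 \<le> x $ i)}"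

text \<open>
  Row vector times matrix; the library only has the product \<open>*\<^sub>v\<close> with a column vector.
  Meaningful when \<open>dim_vec v = dim_row A\<close>.
\<close>

definition vec_mult_mat :: "'a :: semiring_0 vec \<Rightarrow> 'a mat \<Rightarrow> 'a vec" where
  "vec_mult_mat v A = vec (dim_col A) (\<lambda>j. v \<bullet> col A j)"

lemma row_times_mat_eq:
  assumes "dim_vec v = dim_row A"
  shows "mat_of_rows (dim_row A) [v] * A = mat_of_rows (dim_col A) [vec_mult_mat v A]"
  by (rule eq_matI) (auto simp: assms vec_mult_mat_def mat_of_rows_def row_def scalar_prod_def)

end

theory Submission
  imports Defs "HOL-Library.Diagonal_Subsequence" "HOL-Library.Countable"
begin

text \<open>
  The proof is a compactness argument.  For every starting time \<open>-K\<close> the recursion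
  \<open>m (n + 1) = m n P\<^sub>n\<close> can be run forward from any probability vector at time \<open>-K\<close>
  (lemma \<open>ex_solution_from_time\<close>), because a stochastic matrix maps probability vectors to
  probability vectors (lemma \<open>vec_mult_mat_in_prob_vecs\<close>).  It remains to let \<open>K\<close> tend to infinity.
  The numbers \<open>N n\<close> may be unbounded, but the index pairs (time, coordinate) are countable
  and all entries lie in \<open>[0, 1]\<close>, so a diagonal subsequence of the partial solutions converges at
  every such pair (lemma \<open>pointwise_convergent_subsequence\<close>).  The defining conditions of a
  solution at one time involve finitely many entries and are continuous in them, and each of the
  equations holds for all but finitely many \<open>K\<close>; hence the limit satisfies all of them.
\<close>

lemma index_vec_mult_mat:
  assumes "dim_vec v = dim_row A" and "j < dim_col A"
  shows "vec_mult_mat v A $ j = (\<Sum>i<dim_row A. v $ i * A $$ (i, j))"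
  using assms by (simp add: vec_mult_mat_def scalar_prod_def lessThan_atLeast0)

lemma vec_mult_mat_in_prob_vecs:
  assumes v: "v \<in> prob_vecs k" and A: "A \<in> carrier_mat k l" and st: "stochastic_mat A"
  shows "vec_mult_mat v A \<in> prob_vecs l"
proof -
  have dims: "dim_row A = k" "dim_col A = l" "dim_vec v = k"
    using A v by (auto simp: prob_vecs_def)
  have entry: "vec_mult_mat v A $ j = (\<Sum>i<k. v $ i * A $$ (i, j))" if "j < l" for j
    using index_vec_mult_mat[of v A j] dims that by simp
  have "(\<Sum>j<l. vec_mult_mat v A $ j) = (\<Sum>j<l. \<Sum>i<k. v $ i * A $$ (i, j))"
    using entry by simp
  also have "\<dots> = (\<Sum>i<k. v $ i * (\<Sum>j<l. A $$ (i, j)))"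
    by (subst sum.swap) (simp add: sum_distrib_left)
  also have "\<dots> = 1"
    using st v by (simp add: stochastic_mat_def dims prob_vecs_def)
  finally have "(\<Sum>j<l. vec_mult_mat v A $ j) = 1" .
  moreover have "0 \<le> vec_mult_mat v A $ j" if "j < l" for j
    unfolding entry[OF that] using st v that
    by (intro sum_nonneg mult_nonneg_nonneg) (auto simp: stochastic_mat_def dims prob_vecs_def)
  moreover have "vec_mult_mat v A \<in> carrier_vec l"
    using dims by (intro carrier_vecI) (simp add: vec_mult_mat_def)
  ultimately show ?thesis
    by (simp add: prob_vecs_def)
qed

lemma unit_vec_in_prob_vecs:
  assumes "i < k"
  shows "unit_vec k i \<in> prob_vecs k"
proof -
  have "(\<Sum>j<k. (unit_vec k i :: real vec) $ j) = (\<Sum>j<k. if i = j then 1 else 0)"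
    by (intro sum.cong) (auto simp: unit_vec_def)
  also have "\<dots> = 1"
    using assms by simp
  finally show ?thesis
    by (auto simp: prob_vecs_def unit_vec_def)
qed

lemma prob_vec_entry_le_1:
  assumes "x \<in> prob_vecs k" and "i < k"
  shows "x $ i \<le> 1"
proof -
  have "x $ i \<le> (\<Sum>j<k. x $ j)"
    using assms by (intro member_le_sum) (auto simp: prob_vecs_def)
  then show ?thesis
    using assms by (simp add: prob_vecs_def)
qed

primrec propagate :: "(int \<Rightarrow> real mat) \<Rightarrow> int \<Rightarrow> real vec \<Rightarrow> nat \<Rightarrow> real vec" where
  "propagate P a v 0 = v"
| "propagate P a v (Suc k) = vec_mult_mat (propagate P a v k) (P (a + int k))"

lemma propagate_in_prob_vecs:
  fixes N :: "int \<Rightarrow> nat"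
  assumes P: "\<And>n. n < 0 \<Longrightarrow> P n \<in> carrier_mat (N n) (N (n + 1))"
    and st: "\<And>n. n < 0 \<Longrightarrow> stochastic_mat (P n)"
    and v: "v \<in> prob_vecs (N a)" and "a + int k \<le> 0"
  shows "propagate P a v k \<in> prob_vecs (N (a + int k))"
  using \<open>a + int k \<le> 0\<close>
proof (induction k)
  case (Suc k)
  then have "vec_mult_mat (propagate P a v k) (P (a + int k)) \<in> prob_vecs (N (a + int k + 1))"
    by (intro vec_mult_mat_in_prob_vecs[OF _ P st]) auto
  then show ?case
    by (simp add: algebra_simps)
qed (simp add: v)

text \<open>
  Before time \<open>a\<close> the vectors are arbitrary points of the simplices: the equations say nothing
  there, and membership at all times makes the entries bounded uniformly in \<open>a\<close>.
\<close>

lemma ex_solution_from_time: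
  fixes N :: "int \<Rightarrow> nat" and P :: "int \<Rightarrow> real mat"
  assumes pos: "\<And>n. n \<le> 0 \<Longrightarrow> N n > 0"
    and P: "\<And>n. n < 0 \<Longrightarrow> P n \<in> carrier_mat (N n) (N (n + 1))"
    and st: "\<And>n. n < 0 \<Longrightarrow> stochastic_mat (P n)"
    and "a \<le> 0"
  shows "\<exists>m. (\<forall>n\<le>0. m n \<in> prob_vecs (N n)) \<and>
             (\<forall>n. a \<le> n \<and> n < 0 \<longrightarrow> m (n + 1) = vec_mult_mat (m n) (P n))"
proof -
  define e where "e n = (unit_vec (N n) 0 :: real vec)" for n :: int
  define m where "m n = (if n < a then e n else propagate P a (e a) (nat (n - a)))" for n
  have e: "e n \<in> prob_vecs (N n)" if "n \<le> 0" for n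
    unfolding e_def using pos[OF that] by (rule unit_vec_in_prob_vecs)
  have "m n \<in> prob_vecs (N n)" if "n \<le> 0" for n
  proof (cases "n < a")
    case False
    then have "m n = propagate P a (e a) (nat (n - a))" and "a + int (nat (n - a)) = n"
      by (simp_all add: m_def)
    with propagate_in_prob_vecs[where N = N and P = P, OF P st e[OF \<open>a \<le> 0\<close>], of "nat (n - a)"] that
    show ?thesis
      by metis
  qed (use e that in \<open>simp add: m_def\<close>)
  moreover have "m (n + 1) = vec_mult_mat (m n) (P n)" if "a \<le> n" for n
  proof -
    have "nat (n + 1 - a) = Suc (nat (n - a))"
      using that by simp
    then show ?thesis
      using that by (simp add: m_def)
  qed
  ultimately show ?thesis
    by blast
qed

text \<open>
  This is the sequential form of the compactness of a countable product of bounded intervals,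
  obtained by Cantor's diagonal procedure from the Bolzano-Weierstrass theorem.
\<close>

lemma pointwise_convergent_subsequence:
  fixes f :: "nat \<Rightarrow> 'a :: countable \<Rightarrow> real"
  assumes bounded: "\<And>x. Bseq (\<lambda>n. f n x)"
  shows "\<exists>r. strict_mono r \<and> (\<forall>x. convergent (\<lambda>n. f (r n) x))"
proof -
  define conv_at where "conv_at k s \<longleftrightarrow> convergent (\<lambda>n. f (s n) (from_nat k))"
    for k and s :: "nat \<Rightarrow> nat"
  interpret subseqs conv_at
  proof
    fix k and s :: "nat \<Rightarrow> nat"
    let ?g = "\<lambda>n. f (s n) (from_nat k)"
    obtain t where t: "strict_mono t" "monoseq (\<lambda>n. ?g (t n))"
      using seq_monosub[of ?g] by blast
    moreover have "Bseq (\<lambda>n. ?g (t n))"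
      using bounded[of "from_nat k"] unfolding Bseq_def by blast
    ultimately show "\<exists>t. strict_mono t \<and> conv_at k (s \<circ> t)"
      using Bseq_monoseq_convergent by (auto simp: conv_at_def)
  qed
  have "convergent (\<lambda>n. f (diagseq n) x)" for x
  proof -
    \<comment> \<open>Only from index \<open>Suc (to_nat x)\<close> on is the diagonal sequence a subsequence of the one
      chosen for \<open>x\<close>; dropping finitely many terms does not affect convergence.\<close>
    have "conv_at (to_nat x) (diagseq \<circ> ((+) (Suc (to_nat x))))"
    proof (rule diagseq_holds)
      fix r s :: "nat \<Rightarrow> nat" and k
      assume "strict_mono r" "conv_at k s"
      then show "conv_at k (s \<circ> r)"
        using convergent_subseq_convergent[of "\<lambda>n. f (s n) (from_nat k)" r]
        by (simp add: conv_at_def o_def)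
    qed
    then have "convergent (\<lambda>n. f (diagseq (n + Suc (to_nat x))) x)"
      by (simp add: conv_at_def o_def add.commute)
    then show ?thesis
      using convergent_ignore_initial_segment[of "\<lambda>n. f (diagseq n) x"] by blast
  qed
  then show ?thesis
    using subseq_diagseq by blast
qed

lemma prob_vecs_limit:
  assumes X: "\<And>n. X n \<in> prob_vecs k" and x: "x \<in> carrier_vec k"
    and lim: "\<And>i. i < k \<Longrightarrow> (\<lambda>n. X n $ i) \<longlonglongrightarrow> x $ i"
  shows "x \<in> prob_vecs k"
proof -
  have "(\<lambda>n. \<Sum>i<k. X n $ i) \<longlonglongrightarrow> (\<Sum>i<k. x $ i)"
    using lim by (intro tendsto_sum) auto
  then have "(\<Sum>i<k. x $ i) = 1"
    using X LIMSEQ_unique[OF _ tendsto_const] by (fastforce simp: prob_vecs_def)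
  moreover have "0 \<le> x $ i" if "i < k" for i
    using X that by (intro LIMSEQ_le_const[OF lim[OF that]]) (auto simp: prob_vecs_def)
  ultimately show ?thesis
    using x by (simp add: prob_vecs_def)
qed

lemma vec_mult_mat_limit:
  fixes A :: "real mat"
  assumes A: "A \<in> carrier_mat k l"
    and X: "\<And>n. X n \<in> carrier_vec k" and x: "x \<in> carrier_vec k" and y: "y \<in> carrier_vec l"
    and lim_x: "\<And>i. i < k \<Longrightarrow> (\<lambda>n. X n $ i) \<longlonglongrightarrow> x $ i"
    and lim_y: "\<And>j. j < l \<Longrightarrow> (\<lambda>n. Y n $ j) \<longlonglongrightarrow> y $ j"
    and step: "\<forall>\<^sub>F n in sequentially. Y n = vec_mult_mat (X n) A"
  shows "y = vec_mult_mat x A"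
proof (rule eq_vecI)
  fix j assume "j < dim_vec (vec_mult_mat x A)"
  then have j: "j < l"
    using A by (simp add: vec_mult_mat_def)
  have entry: "vec_mult_mat v A $ j = (\<Sum>i<k. v $ i * A $$ (i, j))" if "v \<in> carrier_vec k" for v
    using index_vec_mult_mat[of v A j] A j that by simp
  have "(\<lambda>n. \<Sum>i<k. X n $ i * A $$ (i, j)) \<longlonglongrightarrow> (\<Sum>i<k. x $ i * A $$ (i, j))"
    using lim_x by (intro tendsto_sum tendsto_mult tendsto_const) auto
  moreover have "\<forall>\<^sub>F n in sequentially. (\<Sum>i<k. X n $ i * A $$ (i, j)) = Y n $ j"
    using step by eventually_elim (simp add: entry X)
  ultimately have "(\<lambda>n. Y n $ j) \<longlonglongrightarrow> (\<Sum>i<k. x $ i * A $$ (i, j))"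
    by (rule Lim_transform_eventually)
  then show "y $ j = vec_mult_mat x A $ j"
    using LIMSEQ_unique[OF lim_y[OF j]] entry[OF x] by simp
qed (use A y in \<open>simp add: vec_mult_mat_def\<close>)

theorem theorem2:
  fixes N :: "int \<Rightarrow> nat" and P :: "int \<Rightarrow> real mat"
  assumes "\<And>n. n \<le> 0 \<Longrightarrow> N n > 0"
    and "\<And>n. n < 0 \<Longrightarrow> P n \<in> carrier_mat (N n) (N (n + 1))"
    and "\<And>n. n < 0 \<Longrightarrow> stochastic_mat (P n)"
  shows "\<exists>m :: int \<Rightarrow> real vec.
           (\<forall>n\<le>0. m n \<in> prob_vecs (N n)) \<and>
           (\<forall>n<0. m (n + 1) = vec_mult_mat (m n) (P n))"
proof -
  have "\<exists>m. (\<forall>n\<le>0. m n \<in> prob_vecs (N n)) \<and>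
            (\<forall>n. - int K \<le> n \<and> n < 0 \<longrightarrow> m (n + 1) = vec_mult_mat (m n) (P n))" for K
    using assms by (intro ex_solution_from_time) auto
  then obtain M where M: "\<And>K n. n \<le> 0 \<Longrightarrow> M K n \<in> prob_vecs (N n)"
    and M_step: "\<And>K n. - int K \<le> n \<Longrightarrow> n < 0 \<Longrightarrow> M K (n + 1) = vec_mult_mat (M K n) (P n)"
    by metis
  \<comment> \<open>Extending the entries by \<open>0\<close> lets the countable index type be all of \<open>int \<times> nat\<close>.\<close>
  define f where "f K = (\<lambda>(n, i). if n \<le> 0 \<and> i < N n then M K n $ i else 0)" for K
  have "\<bar>f K x\<bar> \<le> 1" for K x
    using M prob_vec_entry_le_1[OF M] by (cases x) (auto simp: f_def prob_vecs_def)
  then have "Bseq (\<lambda>K. f K x)" for x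
    by (intro BseqI'[where K = 1]) simp
  from pointwise_convergent_subsequence[of f, OF this]
  obtain r where r: "strict_mono r" "\<And>x. convergent (\<lambda>K. f (r K) x)"
    by blast
  define m where "m n = vec (N n) (\<lambda>i. lim (\<lambda>K. f (r K) (n, i)))" for n
  have m_carrier: "m n \<in> carrier_vec (N n)" for n
    by (simp add: m_def)
  have lim_m: "(\<lambda>K. M (r K) n $ i) \<longlonglongrightarrow> m n $ i" if "n \<le> 0" "i < N n" for n i
  proof -
    have "(\<lambda>K. f (r K) (n, i)) \<longlonglongrightarrow> lim (\<lambda>K. f (r K) (n, i))"
      using r(2) by (simp add: convergent_LIMSEQ_iff)
    then show ?thesis
      using that by (simp add: f_def m_def)
  qed
  have "m n \<in> prob_vecs (N n)" if "n \<le> 0" for n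
    using M[OF that] m_carrier lim_m[OF that] by (rule prob_vecs_limit)
  moreover have "m (n + 1) = vec_mult_mat (m n) (P n)" if "n < 0" for n
  proof (rule vec_mult_mat_limit[OF assms(2)[OF that] _ m_carrier m_carrier])
    show "M (r K) n \<in> carrier_vec (N n)" for K
      using M[of n] that by (simp add: prob_vecs_def)
    have "M (r K) (n + 1) = vec_mult_mat (M (r K) n) (P n)" if "nat (- n) \<le> K" for K
      using M_step[of "r K" n] \<open>n < 0\<close> that seq_suble[OF r(1), of K] by linarith
    then show "\<forall>\<^sub>F K in sequentially. M (r K) (n + 1) = vec_mult_mat (M (r K) n) (P n)"
      unfolding eventually_sequentially by blast
  qed (use lim_m that in auto)
  ultimately show ?thesis
    by blast
qed

end
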